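(* Let $\mathcal{A} = (A_{ij}(x))$ be a $p\times q$ matrix of formal power series in $\mathbb{R}[[x]]$. If $\mathcal{A}$ is fully interlacing, then so are the matrices $\mathcal{S}^{(r)}\mathcal{A}$ and $\mathcal{S}^{(r)\perp}\mathcal{A}$ for every positive integer $r$.
   Context: A $\mathbb{Z}\times\mathbb{Z}$ real matrix is totally positive (TP) if every finite square submatrix has nonnegative determinant. For a $p\times q$ matrix $\mathcal{A} = (A_{ij}(x))_{0\le i<p,\,0\le j<q}$ of formal power series $A_{ij}(x) = \sum_{n\ge 0} a_{ij}(n)x^n$ (with $a_{ij}(n) = 0$ for $n<0$), $\mathrm{Lace}(\mathcal{A}) = (M_{uv})_{u,v\in\mathbb{Z}}$ is defined by writing $u = pu'+i$, $v = qv'+j$ with $u',v'\in\mathbb{Z}$, $0\le i<p$, $0\le j<q$, and setting $M_{uv} = a_{ij}(v'-u')$. $\mathcal{A}$ is fully interlacing if $\mathrm{Lace}(\mathcal{A})$ is TP. For integers $0\le k<r$ and $A(x)=\sum_{n\ge0}a_nx^n$, the $k$th Veronese $r$-section is $\mathcal{S}_k^{(r)}A(x) = \sum_{n\ge 0} a_{k+rn}x^n$; $\mathcal{S}_k^{(r)}\mathcal{A}$ denotes the $p\times q$ matrix $(\mathcal{S}_k^{(r)}A_{ij}(x))$. Then $\mathcal{S}^{(r)}\mathcal{A}$ is the $p\times rq$ block matrix $(\mathcal{S}_0^{(r)}\mathcal{A}\ \ \mathcal{S}_1^{(r)}\mathcal{A}\ \cdots\ \mathcal{S}_{r-1}^{(r)}\mathcal{A})$,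 and $\mathcal{S}^{(r)\perp}\mathcal{A}$ is the $rp\times q$ block matrix whose blocks from top to bottom are $\mathcal{S}_{r-1}^{(r)}\mathcal{A}, \dots, \mathcal{S}_1^{(r)}\mathcal{A}, \mathcal{S}_0^{(r)}\mathcal{A}$. *)

theory Defs
  imports
    "HOL-Computational_Algebra.Formal_Power_Series"
    "Jordan_Normal_Form.Determinant"
begin

definition totally_positive :: "(int \<Rightarrow> int \<Rightarrow> real) \<Rightarrow> bool" where
  "totally_positive M \<longleftrightarrow>
     (\<forall>n f g. strict_mono_on {..<n} f \<longrightarrow> strict_mono_on {..<n} g \<longrightarrow>
        0 \<le> det (mat n n (\<lambda>(i, j). M (f i) (g j))))"

definition fps_coeff_int :: "'a::zero fps \<Rightarrow> int \<Rightarrow> 'a" where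
  "fps_coeff_int A n = (if n < 0 then 0 else fps_nth A (nat n))"

text \<open>
  Only meaningful for matrices with at least one row and one column, in which case
  \<open>u = p * (u div p) + u mod p\<close> and \<open>v = q * (v div q) + v mod q\<close> are the
  decompositions of the two indices; see \<open>lace_decomp\<close>.
\<close>

definition lace :: "real fps mat \<Rightarrow> int \<Rightarrow> int \<Rightarrow> real" where
  "lace A u v =
     (let p = int (dim_row A); q = int (dim_col A) in
       fps_coeff_int (A $$ (nat (u mod p), nat (v mod q))) (v div q - u div p))"

lemma lace_decomp:
  assumes "A \<in> carrier_mat p q" and "i < p" and "j < q"
  shows "lace A (int p * u' + int i) (int q * v' + int j) = fps_coeff_int (A $$ (i, j)) (v' - u')"
  using assms by (simp add: lace_def)

definition fully_interlacing :: "real fps mat \<Rightarrow> bool" where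
  "fully_interlacing A \<longleftrightarrow> totally_positive (lace A)"

definition veronese_section :: "nat \<Rightarrow> nat \<Rightarrow> 'a fps \<Rightarrow> 'a fps" where
  "veronese_section r k A = Abs_fps (\<lambda>n. fps_nth A (k + r * n))"

text \<open>
  In a row of \<open>r\<close> blocks with \<open>q\<close> columns each, column \<open>c\<close> is column \<open>c mod q\<close>
  of block \<open>c div q\<close>; likewise for rows of a column of blocks, where the blocks
  are arranged in decreasing order of the section index.
\<close>

definition veronese_row :: "nat \<Rightarrow> 'a fps mat \<Rightarrow> 'a fps mat" where
  "veronese_row r A =
     mat (dim_row A) (r * dim_col A)
       (\<lambda>(i, c). map_mat (veronese_section r (c div dim_col A)) A $$ (i, c mod dim_col A))"

definition veronese_col :: "nat \<Rightarrow> 'a fps mat \<Rightarrow> 'a fps mat" where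
  "veronese_col r A =
     mat (r * dim_row A) (dim_col A)
       (\<lambda>(c, j). map_mat (veronese_section r (r - 1 - c div dim_row A)) A $$ (c mod dim_row A, j))"

end

theory Submission
  imports Defs
begin

text \<open>
  Both laces are submatrices of the lace of \<open>\<A>\<close>: the lace of the row of sections keeps all columns
  and only the rows of every \<open>r\<close>th block of \<open>p\<close> rows, the lace of the column of sections keeps all
  rows and only the columns of every \<open>r\<close>th block of \<open>q\<close> columns. Total positivity passes to
  submatrices.
\<close>

lemma totally_positive_submatrix:
  assumes "totally_positive M" and "strict_mono f" and "strict_mono g"
  shows "totally_positive (\<lambda>u v. M (f u) (g v))"
  unfolding totally_positive_def
proof (intro allI impI)
  fix n and h k :: "nat \<Rightarrow> int"
  assume "strict_mono_on {..<n} h" "strict_mono_on {..<n} k"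
  then have "strict_mono_on {..<n} (f \<circ> h)" "strict_mono_on {..<n} (g \<circ> k)"
    using assms(2,3) by (auto simp: strict_mono_on_def strict_mono_def)
  then have "0 \<le> det (mat n n (\<lambda>(i, j). M ((f \<circ> h) i) ((g \<circ> k) j)))"
    using assms(1) unfolding totally_positive_def by blast
  then show "0 \<le> det (mat n n (\<lambda>(i, j). M (f (h i)) (g (k j))))"
    by simp
qed

text \<open>In blocks of length \<open>m\<close>, this map keeps the position inside a block and
  sends block \<open>b\<close> to block \<open>r * b + s\<close>. It equals \<open>u\<close> plus
  the constant \<open>m * s\<close> plus \<open>m * (r - 1) * (u div m)\<close>; the last term is
  weakly increasing because \<open>1 \<le> r\<close>, so strictness comes from \<open>u\<close>
  itself.\<close>

lemma strict_mono_dilate_blocks: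
  fixes m r s :: int
  assumes "0 < m" and "0 < r"
  shows "strict_mono (\<lambda>u. m * (r * (u div m) + s) + u mod m)"
proof (rule strict_monoI)
  fix u v :: int
  assume "u < v"
  then have le: "u div m \<le> v div m"
    using assms(1) by (simp add: zdiv_mono1)
  have "m * (r - 1) * (u div m) \<le> m * (r - 1) * (v div m)"
    using le assms by (intro mult_left_mono) auto
  moreover have "m * (r * (w div m) + s) + w mod m = m * (r - 1) * (w div m) + m * s + w" for w
    using mult_div_mod_eq[of m w] by (simp add: algebra_simps)
  ultimately show "m * (r * (u div m) + s) + u mod m < m * (r * (v div m) + s) + v mod m"
    using \<open>u < v\<close> by simp
qed

text \<open>The bound \<open>k < r\<close> makes the zero conventions agree: for
  \<open>n \<le> -1\<close> the index \<open>k + r * n\<close> is at most \<open>k - r\<close>,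
  hence negative as well.\<close>

lemma fps_coeff_int_veronese_section:
  assumes "k < r"
  shows "fps_coeff_int (veronese_section r k A) n = fps_coeff_int A (int k + int r * n)"
proof (cases "n < 0")
  case True
  then have "int r * n \<le> int r * (- 1)"
    by (intro mult_left_mono) auto
  with True assms show ?thesis
    by (simp add: fps_coeff_int_def)
next
  case False
  then have "\<not> int k + int r * n < 0"
    by (simp add: not_less)
  note this [simp]
  from False show ?thesis
    by (simp add: fps_coeff_int_def veronese_section_def nat_add_distrib nat_mult_distrib)
qed

lemma int_block_decomp:
  fixes u :: int and m :: nat
  assumes "0 < m"
  obtains u' i where "i < m" and "u = int m * u' + int i"
proof
  show "nat (u mod int m) < m"
    using assms by (simp add: nat_less_iff)
  show "u = int m * (u div int m) + int (nat (u mod int m))"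
    using assms by simp
qed

lemma mult_add_less_mult:
  fixes i k m r :: nat
  assumes "i < m" and "k < r"
  shows "k * m + i < r * m"
proof -
  have "k * m + i < Suc k * m"
    using assms(1) by simp
  also have "\<dots> \<le> r * m"
    using assms(2) by (intro mult_le_mono1) simp
  finally show ?thesis .
qed

text \<open>The two equations read one index in two laces: with period \<open>r * m\<close> in the
  lace of the assembled sections, and with period \<open>m\<close> in the original lace, where
  section block \<open>k\<close> of period \<open>v'\<close> becomes block
  \<open>r * v' + k\<close>.\<close>

lemma int_two_level_block_decomp:
  fixes v :: int and m r :: nat
  assumes "0 < m" and "0 < r"
  obtains v' k j where "k < r" and "j < m"
    and "v = int (r * m) * v' + int (k * m + j)" and "v = int m * (int r * v' + int k) + int j"
proof -
  obtain w j where j: "j < m" "v = int m * w + int j"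
    using int_block_decomp[OF assms(1)] .
  obtain v' k where k: "k < r" "w = int r * v' + int k"
    using int_block_decomp[OF assms(2)] .
  show thesis
    using that[of k j v'] j k by (simp add: algebra_simps)
qed

text \<open>The summand \<open>0\<close> is the offset \<open>s\<close> that puts the row map into
  the form of \<open>strict_mono_dilate_blocks\<close>.\<close>

lemma lace_veronese_row:
  assumes A: "A \<in> carrier_mat p q" and "0 < p" and "0 < q" and "0 < r"
  shows "lace (veronese_row r A) u v
       = lace A (int p * (int r * (u div int p) + 0) + u mod int p) v"
proof -
  obtain u' i where i: "i < p" "u = int p * u' + int i"
    using int_block_decomp[OF \<open>0 < p\<close>] .
  obtain v' k j where kj: "k < r" "j < q"
    and v: "v = int (r * q) * v' + int (k * q + j)" "v = int q * (int r * v' + int k) + int j"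
    using int_two_level_block_decomp[OF \<open>0 < q\<close> \<open>0 < r\<close>] .
  have c: "k * q + j < r * q"
    using kj by (simp add: mult_add_less_mult)
  have "veronese_row r A \<in> carrier_mat p (r * q)"
    using A by (simp add: veronese_row_def)
  then have "lace (veronese_row r A) u v
      = fps_coeff_int (veronese_row r A $$ (i, k * q + j)) (v' - u')"
    unfolding i(2) v(1) using i(1) c by (rule lace_decomp)
  also have "veronese_row r A $$ (i, k * q + j) = veronese_section r k (A $$ (i, j))"
    using A i(1) kj c by (simp add: veronese_row_def)
  \<comment> \<open>Regrouping \<open>k + r * (v' - u')\<close> lets the column block absorb
    \<open>k\<close>: it becomes \<open>r * v' + k\<close>, which is the block of \<open>v\<close>
    itself, and only the row block is dilated, to \<open>r * u'\<close>.\<close>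
  also have "fps_coeff_int \<dots> (v' - u')
      = fps_coeff_int (A $$ (i, j)) ((int r * v' + int k) - int r * u')"
    using kj(1) by (simp add: fps_coeff_int_veronese_section algebra_simps)
  also have "\<dots> = lace A (int p * (int r * u') + int i) v"
    unfolding v(2) using A i(1) kj(2) by (rule lace_decomp[symmetric])
  finally show ?thesis
    using i by simp
qed

lemma lace_veronese_col:
  assumes A: "A \<in> carrier_mat p q" and "0 < p" and "0 < q" and "0 < r"
  shows "lace (veronese_col r A) u v
       = lace A u (int q * (int r * (v div int q) + (int r - 1)) + v mod int q)"
proof -
  obtain v' j where j: "j < q" "v = int q * v' + int j"
    using int_block_decomp[OF \<open>0 < q\<close>] .
  obtain u' k i where ki: "k < r" "i < p"
    and u: "u = int (r * p) * u' + int (k * p + i)" "u = int p * (int r * u' + int k) + int i"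
    using int_two_level_block_decomp[OF \<open>0 < p\<close> \<open>0 < r\<close>] .
  have c: "k * p + i < r * p"
    using ki by (simp add: mult_add_less_mult)
  have "veronese_col r A \<in> carrier_mat (r * p) q"
    using A by (simp add: veronese_col_def)
  then have "lace (veronese_col r A) u v
      = fps_coeff_int (veronese_col r A $$ (k * p + i, j)) (v' - u')"
    unfolding j(2) u(1) using c j(1) by (rule lace_decomp)
  also have "veronese_col r A $$ (k * p + i, j) = veronese_section r (r - 1 - k) (A $$ (i, j))"
    using A j(1) ki c by (simp add: veronese_col_def)
  \<comment> \<open>The decreasing order of the sections gives \<open>k\<close> a minus sign, so it
    joins the row block \<open>r * u' + k\<close> and the row index stays \<open>u\<close>. The
    remaining \<open>r - 1\<close> is a constant offset of the column block.\<close>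
  also have "fps_coeff_int \<dots> (v' - u')
      = fps_coeff_int (A $$ (i, j)) ((int r * v' + (int r - 1)) - (int r * u' + int k))"
    using ki(1) by (simp add: fps_coeff_int_veronese_section algebra_simps of_nat_diff)
  also have "\<dots> = lace A u (int q * (int r * v' + (int r - 1)) + int j)"
    unfolding u(2) using A ki(2) j(1) by (rule lace_decomp[symmetric])
  finally show ?thesis
    using j by simp
qed

theorem theorem5p3:
  fixes A :: "real fps mat" and p q r :: nat
  assumes "0 < p" and "0 < q"
    and "A \<in> carrier_mat p q"
    and "fully_interlacing A"
    and "0 < r"
  shows "fully_interlacing (veronese_row r A) \<and> fully_interlacing (veronese_col r A)"
proof
  have tp: "totally_positive (lace A)"
    using assms(4) by (simp add: fully_interlacing_def)
  \<comment> \<open>The identity acts on the columns for the row of sections and on the rows for the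
    column of sections.\<close>
  have id: "strict_mono (\<lambda>u::int. u)"
    by (simp add: strict_mono_def)
  have row: "lace (veronese_row r A)
      = (\<lambda>u v. lace A (int p * (int r * (u div int p) + 0) + u mod int p) v)"
    by (intro ext lace_veronese_row[OF assms(3,1,2,5)])
  show "fully_interlacing (veronese_row r A)"
    unfolding fully_interlacing_def row using assms(1,5)
    by (intro totally_positive_submatrix[OF tp _ id] strict_mono_dilate_blocks) simp_all
  have col: "lace (veronese_col r A)
      = (\<lambda>u v. lace A u (int q * (int r * (v div int q) + (int r - 1)) + v mod int q))"
    by (intro ext lace_veronese_col[OF assms(3,1,2,5)])
  show "fully_interlacing (veronese_col r A)"
    unfolding fully_interlacing_def col using assms(2,5)
    by (intro totally_positive_submatrix[OF tp id] strict_mono_dilate_blocks) simp_all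
qed

end
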